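(* Let $f\in\mathbb{R}[X_1,\dots,X_n]$ with $\deg f=d>0$ and homogeneous components $f_0,\dots,f_d$. Fix $p\in[1,\infty]$ and let $c_1,\dots,c_d\in\mathbb{R}$ be such that $f_j(x)\ge c_j$ for all $x\in\mathbb{S}^{n-1}_p$ and $j=1,\dots,d$. Suppose $c_d>0$. Let $R$ denote the largest nonnegative real root of the univariate polynomial $q:\mathbb{R}\to\mathbb{R}$, $q(\lambda):=\sum_{j=1}^d c_j\lambda^j$. 1. Then integer minimizers as well as continuous minimizers of $f$ exist, and every integer or continuous minimizer $x'$ of $f$ satisfies $\|x'\|_p\le R$. 2. If $x^*$ is any integer minimizer of $f$, then $|x^*_i|\le\lfloor R\rfloor$ for $i=1,\dots,n$.
   Context: For $f$ of degree $d$, write uniquely $f=\sum_{j=0}^d f_j$ with $f_j$ homogeneous of degree $j$ (the homogeneous components of $f$). $\mathbb{S}^{n-1}_p=\{x\in\mathbb{R}^n\mid \|x\|_p=1\}$ is the unit sphere of the $p$-norm. An integer (resp. continuous) minimizer of $f$ is a point of $\mathbb{Z}^n$ (resp. $\mathbb{R}^n$) at which $f$ attains its minimum over $\mathbb{Z}^n$ (resp. $\mathbb{R}^n$). *)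

theory Defs
  imports "HOL-Analysis.Analysis" "HOL-Library.Poly_Mapping"
begin

(* A monomial is its exponent vector, a polynomial its finitely supported family of
   coefficients. The variables are indexed by the finite type 'n. *)

type_synonym 'n monom = "'n \<Rightarrow>\<^sub>0 nat"
type_synonym 'n rpoly = "'n monom \<Rightarrow>\<^sub>0 real"

definition mdeg :: "('n::finite) monom \<Rightarrow> nat"
  where "mdeg m = (\<Sum>i\<in>UNIV. Poly_Mapping.lookup m i)"

definition meval :: "('n::finite) monom \<Rightarrow> real^'n \<Rightarrow> real"
  where "meval m x = (\<Prod>i\<in>UNIV. (x $ i) ^ Poly_Mapping.lookup m i)"

definition peval :: "('n::finite) rpoly \<Rightarrow> real^'n \<Rightarrow> real"
  where "peval f x = (\<Sum>m\<in>Poly_Mapping.keys f. Poly_Mapping.lookup f m * meval m x)"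

(* The inserted 0 only gives the zero polynomial degree 0. *)
definition total_deg :: "('n::finite) rpoly \<Rightarrow> nat"
  where "total_deg f = Max (insert 0 (mdeg ` Poly_Mapping.keys f))"

definition homogeneous :: "nat \<Rightarrow> ('n::finite) rpoly \<Rightarrow> bool"
  where "homogeneous j f \<longleftrightarrow> (\<forall>m\<in>Poly_Mapping.keys f. mdeg m = j)"

definition hom_component :: "nat \<Rightarrow> ('n::finite) rpoly \<Rightarrow> 'n rpoly"
  where "hom_component j f = (\<Sum>m\<in>{m \<in> Poly_Mapping.keys f. mdeg m = j}. Poly_Mapping.single m (Poly_Mapping.lookup f m))"

(* For p = \<infinity>, infnorm x is the maximum of the absolute values of the coordinates. *)
definition pnorm :: "ereal \<Rightarrow> real^('n::finite) \<Rightarrow> real"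
  where "pnorm p x =
    (if p = \<infinity> then infnorm x
     else (\<Sum>i\<in>UNIV. \<bar>x $ i\<bar> powr real_of_ereal p) powr (1 / real_of_ereal p))"

definition int_points :: "(real^('n::finite)) set"
  where "int_points = {x. \<forall>i. x $ i \<in> \<int>}"

definition integer_minimizer :: "('n::finite) rpoly \<Rightarrow> real^'n \<Rightarrow> bool"
  where "integer_minimizer f x \<longleftrightarrow> is_arg_min (peval f) (\<lambda>y. y \<in> int_points) x"

definition continuous_minimizer :: "('n::finite) rpoly \<Rightarrow> real^'n \<Rightarrow> bool"
  where "continuous_minimizer f x \<longleftrightarrow> is_arg_min (peval f) (\<lambda>y. True) x"

lemma lookup_hom_component:
  "Poly_Mapping.lookup (hom_component j f) m = (if mdeg m = j then Poly_Mapping.lookup f m else 0)"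
proof -
  have "Poly_Mapping.lookup (hom_component j f) m
      = (\<Sum>k\<in>{k \<in> Poly_Mapping.keys f. mdeg k = j}. if k = m then Poly_Mapping.lookup f k else 0)"
    unfolding hom_component_def lookup_sum by (simp add: lookup_single when_def)
  also have "\<dots> = (if m \<in> {k \<in> Poly_Mapping.keys f. mdeg k = j} then Poly_Mapping.lookup f m else 0)"
    by (subst sum.delta) auto
  also have "\<dots> = (if mdeg m = j then Poly_Mapping.lookup f m else 0)"
    by (auto simp: in_keys_iff)
  finally show ?thesis .
qed

lemma mdeg_le_total_deg: "m \<in> Poly_Mapping.keys f \<Longrightarrow> mdeg m \<le> total_deg f"
  unfolding total_deg_def by (intro Max_ge) auto

lemma homogeneous_hom_component: "homogeneous j (hom_component j f)"
  by (auto simp: homogeneous_def in_keys_iff lookup_hom_component split: if_splits)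

lemma sum_hom_component: "(\<Sum>j\<le>total_deg f. hom_component j f) = f"
proof (rule poly_mapping_eqI)
  fix m
  show "Poly_Mapping.lookup (\<Sum>j\<le>total_deg f. hom_component j f) m = Poly_Mapping.lookup f m"
    using mdeg_le_total_deg[of m f]
    by (auto simp: lookup_sum lookup_hom_component in_keys_iff)
qed

lemma hom_component_unique:
  assumes "\<And>j. j \<le> d \<Longrightarrow> homogeneous j (g j)" and "f = (\<Sum>j\<le>d. g j)" and "j \<le> d"
  shows "g j = hom_component j f"
proof (rule poly_mapping_eqI)
  fix m
  have *: "Poly_Mapping.lookup (g i) m = 0" if "i \<le> d" "i \<noteq> mdeg m" for i
    using assms(1)[OF that(1)] that(2) by (auto simp: homogeneous_def in_keys_iff)
  have "Poly_Mapping.lookup f m = (\<Sum>i\<le>d. Poly_Mapping.lookup (g i) m)"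
    by (simp add: assms(2) lookup_sum)
  also have "\<dots> = (\<Sum>i\<le>d. if mdeg m = i then Poly_Mapping.lookup (g i) m else 0)"
    using * by (intro sum.cong) auto
  also have "\<dots> = (if mdeg m \<le> d then Poly_Mapping.lookup (g (mdeg m)) m else 0)"
    by simp
  finally have "Poly_Mapping.lookup f m
      = (if mdeg m \<le> d then Poly_Mapping.lookup (g (mdeg m)) m else 0)" .
  with *[OF assms(3)] assms(3) show "Poly_Mapping.lookup (g j) m = Poly_Mapping.lookup (hom_component j f) m"
    by (cases "j = mdeg m") (simp_all add: lookup_hom_component)
qed

end

theory Submission
  imports Defs
begin

text \<open>
  Everything rests on the lower bound \<open>f x \<ge> f 0 + q (\<parallel>x\<parallel>\<^sub>p)\<close>. It comes from writing a nonzero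
  point as \<open>x = t u\<close> with \<open>t = \<parallel>x\<parallel>\<^sub>p\<close> and \<open>u\<close> on the unit sphere, because homogeneity turns
  \<open>f x\<close> into \<open>\<Sum>j. t ^ j * f\<^sub>j u\<close>, whose constant term is \<open>f 0\<close> and whose other terms are at
  least \<open>c\<^sub>j t ^ j\<close> (\<open>peval_lower_bound\<close>).

  Since \<open>c\<^sub>d > 0\<close>, the polynomial \<open>q\<close> tends to infinity, so beyond its largest root \<open>R\<close> it
  is positive (\<open>poly_pos_beyond_largest_root\<close>). Hence \<open>f x > f 0\<close> as soon as
  \<open>\<parallel>x\<parallel>\<^sub>p > R\<close>. The origin is a competitor over the integer lattice as well as over the whole
  space, so no minimizer can lie outside the \<open>p\<close>-ball of radius \<open>R\<close>.

  For existence, coordinates are bounded by the \<open>p\<close>-norm, so outside the cube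
  \<open>[-R, R]\<^sup>n\<close> the values of \<open>f\<close> exceed \<open>f 0\<close>. Over any closed set containing the origin, it is
  therefore enough to minimize over the compact part inside the cube
  (\<open>arg_min_exists_if_large_outside_cube\<close>); both the lattice and the whole space are closed.
  The cube serves because it is compact in the product topology, whatever \<open>p\<close> is.
  Finally, the coordinates of an integer minimizer are integers of absolute value at most
  \<open>R\<close>, hence at most \<open>\<lfloor>R\<rfloor>\<close>.
\<close>

section \<open>Homogeneous components and evaluation\<close>

lemma meval_scaleR: "meval m (s *\<^sub>R x) = s ^ mdeg m * meval m x"
  by (simp add: meval_def mdeg_def power_mult_distrib prod.distrib power_sum)

lemma peval_homogeneous_scaleR:
  assumes "homogeneous j g"
  shows "peval g (s *\<^sub>R x) = s ^ j * peval g x"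
proof -
  have "peval g (s *\<^sub>R x) = (\<Sum>m\<in>Poly_Mapping.keys g. s ^ j * (Poly_Mapping.lookup g m * meval m x))"
    unfolding peval_def using assms
    by (intro sum.cong) (auto simp: meval_scaleR homogeneous_def)
  then show ?thesis
    by (simp add: peval_def sum_distrib_left)
qed

lemma peval_hom_component:
  "peval (hom_component j f) x
    = (\<Sum>m\<in>{m \<in> Poly_Mapping.keys f. mdeg m = j}. Poly_Mapping.lookup f m * meval m x)"
proof -
  have "Poly_Mapping.keys (hom_component j f) = {m \<in> Poly_Mapping.keys f. mdeg m = j}"
    by (auto simp: in_keys_iff lookup_hom_component split: if_splits)
  then show ?thesis
    by (auto simp: peval_def lookup_hom_component intro!: sum.cong)
qed

lemma peval_eq_sum_hom_components:
  "peval f x = (\<Sum>j\<le>total_deg f. peval (hom_component j f) x)"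
proof -
  have "(\<Sum>j\<in>{..total_deg f}. peval (hom_component j f) x) = peval f x"
    unfolding peval_hom_component peval_def[of f]
    by (rule sum.group) (auto simp: mdeg_le_total_deg)
  then show ?thesis by simp
qed

text \<open>
  Scaling by \<open>0\<close> kills every component except the one of degree \<open>0\<close>, where \<open>0 ^ 0 = 1\<close>.
\<close>

lemma peval_hom_component_0: "peval (hom_component 0 f) x = peval f 0"
proof -
  have scale0: "peval (hom_component j f) 0 = 0 ^ j * peval (hom_component j f) x" for j
    using peval_homogeneous_scaleR[OF homogeneous_hom_component, of j f 0 x] by simp
  have "peval f 0 = (\<Sum>j\<le>total_deg f. if j = 0 then peval (hom_component 0 f) x else 0)"
    unfolding peval_eq_sum_hom_components[of f 0]
    by (intro sum.cong) (auto simp: scale0)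
  then show ?thesis by simp
qed

lemma continuous_on_peval: "continuous_on S (peval f)"
  unfolding peval_def meval_def by (intro continuous_intros)

section \<open>The p-norm\<close>

lemma abs_component_le_pnorm:
  assumes "0 < p"
  shows "\<bar>x $ i\<bar> \<le> pnorm p x"
proof (cases p)
  case (real r)
  with assms have r: "r > 0" by simp
  have "\<bar>x $ i\<bar> powr r \<le> (\<Sum>i\<in>UNIV. \<bar>x $ i\<bar> powr r)"
    by (rule member_le_sum) auto
  then have "(\<bar>x $ i\<bar> powr r) powr (1 / r) \<le> (\<Sum>i\<in>UNIV. \<bar>x $ i\<bar> powr r) powr (1 / r)"
    using r by (intro powr_mono2) auto
  then show ?thesis
    using r real by (simp add: pnorm_def powr_powr)
next
  case PInf
  then show ?thesis
    by (simp add: pnorm_def component_le_infnorm_cart)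
qed (use assms in auto)

lemma pnorm_scaleR:
  assumes "0 < p"
  shows "pnorm p (s *\<^sub>R x) = \<bar>s\<bar> * pnorm p x"
proof (cases p)
  case (real r)
  with assms have r: "r > 0" by simp
  have "(\<Sum>i\<in>UNIV. \<bar>(s *\<^sub>R x) $ i\<bar> powr r) = \<bar>s\<bar> powr r * (\<Sum>i\<in>UNIV. \<bar>x $ i\<bar> powr r)"
    by (simp add: abs_mult powr_mult sum_distrib_left)
  then show ?thesis
    using r real by (simp add: pnorm_def powr_mult powr_powr sum_nonneg)
next
  case PInf
  then show ?thesis
    by (simp add: pnorm_def infnorm_mul)
qed (use assms in auto)

lemma pnorm_pos:
  assumes "0 < p" "x \<noteq> 0"
  shows "0 < pnorm p x"
proof -
  obtain i where "x $ i \<noteq> 0"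
    using assms(2) by (auto simp: vec_eq_iff)
  then show ?thesis
    using abs_component_le_pnorm[OF assms(1), of x i] by linarith
qed

section \<open>The lower bound by a univariate polynomial\<close>

text \<open>
  The bounds on the unit sphere are transported to a nonzero point along its ray from the origin:
  the component of degree \<open>j\<close> grows along that ray like the \<open>j\<close>-th power of the norm.
\<close>

lemma peval_lower_bound:
  assumes p: "0 < p"
    and c: "\<And>j u. j \<in> {1..total_deg f} \<Longrightarrow> pnorm p u = 1 \<Longrightarrow> c j \<le> peval (hom_component j f) u"
    and x: "x \<noteq> 0"
  shows "peval f 0 + (\<Sum>j=1..total_deg f. c j * pnorm p x ^ j) \<le> peval f x"
proof -
  define t where "t = pnorm p x"
  define u where "u = (1 / t) *\<^sub>R x"
  have t: "t > 0"
    unfolding t_def using p x by (rule pnorm_pos)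
  have u: "pnorm p u = 1"
    using t by (simp add: u_def pnorm_scaleR[OF p] flip: t_def)
  have xu: "x = t *\<^sub>R u"
    using t by (simp add: u_def)
  have "c j * t ^ j \<le> peval (hom_component j f) x" if "j \<in> {1..total_deg f}" for j
    using mult_right_mono[OF c[OF that u], of "t ^ j"] t
    by (simp add: xu peval_homogeneous_scaleR[OF homogeneous_hom_component] mult.commute)
  then have "(\<Sum>j=1..total_deg f. c j * t ^ j) \<le> (\<Sum>j=1..total_deg f. peval (hom_component j f) x)"
    by (rule sum_mono)
  moreover have "{..total_deg f} = insert 0 {1..total_deg f}"
    by auto
  then have "peval f x = peval f 0 + (\<Sum>j=1..total_deg f. peval (hom_component j f) x)"
    by (simp add: peval_eq_sum_hom_components[of f x] peval_hom_component_0)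
  ultimately show ?thesis
    by (simp add: t_def)
qed

text \<open>
  A nonpositive value beyond the last root would, by the intermediate value theorem, force
  another root further right, since the polynomial is eventually positive.
\<close>

lemma poly_pos_beyond_largest_root:
  fixes Q :: "real poly"
  assumes lc: "0 < lead_coeff Q"
    and t: "0 \<le> t" "Max {s. 0 \<le> s \<and> poly Q s = 0} < t"
  shows "0 < poly Q t"
proof (rule ccontr)
  assume neg: "\<not> 0 < poly Q t"
  have "Q \<noteq> 0"
    using lc by auto
  then have fin: "finite {s. 0 \<le> s \<and> poly Q s = 0}"
    using poly_roots_finite[of Q] by (auto intro: finite_subset[rotated])
  obtain N where N: "\<And>s. s \<ge> N \<Longrightarrow> lead_coeff Q \<le> poly Q s"
    using poly_pinfty_gt_lc[OF lc] by blast
  have "0 \<le> poly Q (max N t)"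
    using N[of "max N t"] lc by linarith
  moreover have "continuous_on {t..max N t} (poly Q)"
    by (intro continuous_intros)
  ultimately obtain s where "t \<le> s" "poly Q s = 0"
    using IVT'[of "poly Q" t 0 "max N t"] neg by fastforce
  then have "s \<le> Max {s. 0 \<le> s \<and> poly Q s = 0}"
    using fin t(1) by (intro Max_ge) auto
  with \<open>t \<le> s\<close> t(2) show False by linarith
qed

section \<open>Existence of minimizers\<close>

lemma closed_int_points: "closed (int_points :: (real^('n::finite)) set)"
proof -
  have "int_points = (\<Inter>i. (\<lambda>x :: real^'n. x $ i) -` \<int>)"
    by (auto simp: int_points_def)
  moreover have "closed (\<Inter>i. (\<lambda>x :: real^'n. x $ i) -` \<int>)"
    by (intro closed_INT ballI closed_vimage closed_Ints continuous_intros)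
  ultimately show ?thesis by simp
qed

text \<open>
  A minimum over the compact part of \<open>S\<close> inside the cube is at most the value at the origin, which
  lies in that part, and so it also beats every point of \<open>S\<close> outside.
\<close>

lemma arg_min_exists_if_large_outside_cube:
  fixes g :: "real^('n::finite) \<Rightarrow> real"
  assumes "continuous_on UNIV g" "closed S" "0 \<in> S"
    and R: "0 \<le> R" "\<And>x i. R < \<bar>x $ i\<bar> \<Longrightarrow> g 0 < g x"
  shows "\<exists>x. is_arg_min g (\<lambda>y. y \<in> S) x"
proof -
  define B :: "(real^'n) set" where "B = cbox (\<chi> i. - R) (\<chi> i. R)"
  have B: "x \<in> B \<longleftrightarrow> (\<forall>i. \<bar>x $ i\<bar> \<le> R)" for x
    by (auto simp: B_def mem_box_cart abs_le_iff) (metis minus_le_iff)+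
  have "compact (S \<inter> B)"
    unfolding B_def using \<open>closed S\<close> by (intro closed_Int_compact compact_cbox)
  moreover have 0: "0 \<in> S \<inter> B"
    using \<open>0 \<in> S\<close> R(1) by (simp add: B)
  moreover have "continuous_on (S \<inter> B) g"
    using assms(1) by (rule continuous_on_subset) simp
  ultimately obtain x where x: "x \<in> S \<inter> B" "\<forall>y\<in>S \<inter> B. g x \<le> g y"
    using continuous_attains_inf[of "S \<inter> B" g] by blast
  have "g x \<le> g y" if "y \<in> S" for y
  proof (cases "y \<in> B")
    case False
    then have "g 0 < g y"
      using R(2) by (auto simp: B not_le)
    moreover have "g x \<le> g 0"
      using x(2) 0 by blast
    ultimately show ?thesis by linarith
  qed (use x that in auto)
  with x(1) show ?thesis
    by (auto simp: is_arg_min_linorder)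
qed

section \<open>The norm bound on minimizers\<close>

theorem theorem6:
  fixes f :: "('n::finite) rpoly" and d :: nat and p :: ereal
    and c :: "nat \<Rightarrow> real" and q :: "real \<Rightarrow> real" and R :: real
  assumes deg: "total_deg f = d" and d_pos: "d > 0"
    and p: "1 \<le> p"
    and c: "\<And>j x. j \<in> {1..d} \<Longrightarrow> pnorm p x = 1 \<Longrightarrow> peval (hom_component j f) x \<ge> c j"
    and c_d: "c d > 0"
    and q: "q = (\<lambda>t. \<Sum>j=1..d. c j * t ^ j)"
    and R: "R = Max {t. 0 \<le> t \<and> q t = 0}"
  shows "(\<exists>x. integer_minimizer f x) \<and> (\<exists>x. continuous_minimizer f x) \<and>
      (\<forall>x. integer_minimizer f x \<or> continuous_minimizer f x \<longrightarrow> pnorm p x \<le> R) \<and>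
      (\<forall>x. integer_minimizer f x \<longrightarrow> (\<forall>i. \<bar>x $ i\<bar> \<le> of_int \<lfloor>R\<rfloor>))"
proof -
  have p0: "0 < p"
    using p by (rule less_le_trans[rotated]) simp
  define Q where "Q = (\<Sum>j=1..d. monom (c j) j)"
  have qQ: "q t = poly Q t" for t
    by (simp add: q Q_def poly_sum poly_monom)
  have coeff_Q: "coeff Q i = (if i \<in> {1..d} then c i else 0)" for i
    by (simp add: Q_def coeff_sum)
  have "degree Q = d"
  proof (rule antisym)
    show "degree Q \<le> d"
      by (rule degree_le) (simp add: coeff_Q)
    show "d \<le> degree Q"
      using c_d d_pos by (intro le_degree) (simp add: coeff_Q)
  qed
  then have lc: "0 < lead_coeff Q"
    using c_d d_pos by (simp add: coeff_Q)
  then have "finite {t. poly Q t = 0}"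
    by (intro poly_roots_finite) auto
  then have "finite {t. 0 \<le> t \<and> q t = 0}"
    unfolding qQ by (rule finite_subset[rotated]) auto
  moreover have "q 0 = 0"
    unfolding q by (intro sum.neutral) auto
  ultimately have R0: "0 \<le> R"
    unfolding R by (intro Max_ge) auto

  have large: "peval f 0 < peval f x" if "R < pnorm p x" for x
  proof (cases "x = 0")
    case True
    have "pnorm p (0 :: real^'n) = 0"
      using pnorm_scaleR[OF p0, of 0 "0 :: real^'n"] by simp
    with that R0 True show ?thesis by simp
  next
    case False
    have "0 < q (pnorm p x)"
      using poly_pos_beyond_largest_root[OF lc, of "pnorm p x"] that R0
      by (simp add: R qQ)
    moreover have "peval f 0 + q (pnorm p x) \<le> peval f x"
      using peval_lower_bound[OF p0, of f c x] c False by (simp add: deg q)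
    ultimately show ?thesis by linarith
  qed
  have large': "peval f 0 < peval f x" if "R < \<bar>x $ i\<bar>" for x i
    using that abs_component_le_pnorm[OF p0, of x i] by (intro large) linarith

  have 0: "(0 :: real^'n) \<in> int_points"
    by (simp add: int_points_def)
  have "\<exists>x. integer_minimizer f x"
    unfolding integer_minimizer_def
    by (rule arg_min_exists_if_large_outside_cube[OF continuous_on_peval closed_int_points 0 R0 large'])
  moreover have "\<exists>x. continuous_minimizer f x"
    using arg_min_exists_if_large_outside_cube[OF continuous_on_peval closed_UNIV UNIV_I R0 large']
    by (simp add: continuous_minimizer_def)
  moreover have bound: "pnorm p x \<le> R" if "integer_minimizer f x \<or> continuous_minimizer f x" for x
  proof -
    have "peval f x \<le> peval f 0"
      using that 0 by (auto simp: integer_minimizer_def continuous_minimizer_def is_arg_min_linorder)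
    with large[of x] show ?thesis by linarith
  qed
  moreover have "\<bar>x $ i\<bar> \<le> of_int \<lfloor>R\<rfloor>" if "integer_minimizer f x" for x i
  proof -
    have "x $ i \<in> \<int>"
      using that by (auto simp: integer_minimizer_def int_points_def is_arg_min_def)
    then obtain k where k: "\<bar>x $ i\<bar> = of_int k"
      by (metis Ints_abs Ints_cases)
    have "\<bar>x $ i\<bar> \<le> R"
      using abs_component_le_pnorm[OF p0, of x i] bound that by fastforce
    then show ?thesis
      by (simp add: k le_floor_iff)
  qed
  ultimately show ?thesis by blast
qed

end
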